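(* Let $\mathcal G=(\mathcal V,\mathcal E,W)$ be a directed weighted graph with $\mathcal V=\{1,\dots,n\}$, let $\theta\in[0,1]^n$ be a threshold vector, and let $C_1,\dots,C_n:\mathbb{R}_+\to\mathbb{R}_+$ be non-decreasing lower semicontinuous cost functions. Then the least activation cost $$C^*=\min\Big\{\sum_{i}C_i(h_i)\;\Big|\;h\in\mathcal H\Big\}$$ satisfies $$C^*=\min_{\sigma\in\mathcal S_n}C(\sigma).$$
   Context: $\mathbb{R}_+=[0,+\infty)$. A directed weighted graph $\mathcal G=(\mathcal V,\mathcal E,W)$ has node set $\mathcal V=\{1,\dots,n\}$, link set $\mathcal E\subseteq\mathcal V\times\mathcal V$ and weight matrix $W\in\mathbb{R}_+^{n\times n}$ with $W_{ij}>0$ if and only if $(i,j)\in\mathcal E$. Put $w_i=\sum_j W_{ij}$. For $\alpha\in\mathbb{R}$, $f_\alpha(x)=0$ if $x<\alpha$ and $f_\alpha(x)=1$ if $x\ge\alpha$. For $h\in\mathbb{R}_+^n$, the map $F_h:\{0,1\}^n\to\{0,1\}^n$ is $(F_h(x))_i=f_{\theta_iw_i-h_i}\big(\sum_j W_{ij}x_j\big)$. The set of successful interventions is $$\mathcal H=\Big\{h\in\mathbb{R}_+^n \;\Big|\; \lim_{t\to+\infty}F_h^t(x(0))=\mathbf 1 \text{ for every } x(0)\in\{0,1\}^n\Big\},$$ where $\mathbf 1$ is the all-one vector. $\mathcal S_n$ is the group of permutations $\sigma=(\sigma_1,\dots,\sigma_n)$ of $\mathcal V$. For $\sigma\in\mathcal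 S_n$ and $1\le t\le n$, $$w_{\sigma_t}(\sigma)=\sum_{1\le s<t}W_{\sigma_t\sigma_s},$$ and the cost of $\sigma$ is $$C(\sigma)=\sum_{1\le i\le n}C_i\big([\theta_iw_i-w_i(\sigma)]^+\big),\qquad [x]^+=\max\{0,x\}.$$ *)

theory Defs
  imports "HOL-Analysis.Analysis"
begin

text \<open>
  The node set is \<open>{1..n}\<close>. Vectors indexed by the nodes are extensional functions on
  \<open>{1..n}\<close> (\<open>\<rightarrow>\<^sub>E\<close>), so that they correspond one-to-one to n-tuples; limits of such vectors
  are taken in the product topology on \<open>nat \<Rightarrow> real\<close>. Values of the remaining data
  (weights, thresholds, cost functions) outside \<open>{1..n}\<close> are never used.
\<close>

definition weighted_digraph :: "nat \<Rightarrow> (nat \<times> nat) set \<Rightarrow> (nat \<Rightarrow> nat \<Rightarrow> real) \<Rightarrow> bool" where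
  "weighted_digraph n E W \<longleftrightarrow>
     E \<subseteq> {1..n} \<times> {1..n} \<and>
     (\<forall>i\<in>{1..n}. \<forall>j\<in>{1..n}. 0 \<le> W i j \<and> (0 < W i j \<longleftrightarrow> (i, j) \<in> E))"

definition out_weight :: "nat \<Rightarrow> (nat \<Rightarrow> nat \<Rightarrow> real) \<Rightarrow> nat \<Rightarrow> real" where
  "out_weight n W i = (\<Sum>j\<in>{1..n}. W i j)"

definition step_fun :: "real \<Rightarrow> real \<Rightarrow> real" where
  "step_fun \<alpha> x = (if x < \<alpha> then 0 else 1)"

definition states :: "nat \<Rightarrow> (nat \<Rightarrow> real) set" where
  "states n = {1..n} \<rightarrow>\<^sub>E {0, 1}"

definition all_one :: "nat \<Rightarrow> nat \<Rightarrow> real" where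
  "all_one n = (\<lambda>i\<in>{1..n}. 1)"

definition threshold_map ::
  "nat \<Rightarrow> (nat \<Rightarrow> nat \<Rightarrow> real) \<Rightarrow> (nat \<Rightarrow> real) \<Rightarrow> (nat \<Rightarrow> real) \<Rightarrow> (nat \<Rightarrow> real) \<Rightarrow> nat \<Rightarrow> real" where
  "threshold_map n W \<theta> h x =
     (\<lambda>i\<in>{1..n}. step_fun (\<theta> i * out_weight n W i - h i) (\<Sum>j\<in>{1..n}. W i j * x j))"

lemma threshold_map_in_states: "threshold_map n W \<theta> h x \<in> states n"
  by (auto simp: threshold_map_def states_def step_fun_def)

definition successful_interventions ::
  "nat \<Rightarrow> (nat \<Rightarrow> nat \<Rightarrow> real) \<Rightarrow> (nat \<Rightarrow> real) \<Rightarrow> (nat \<Rightarrow> real) set" where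
  "successful_interventions n W \<theta> =
     {h \<in> {1..n} \<rightarrow>\<^sub>E {0..}.
        \<forall>x0\<in>states n. (\<lambda>t. (threshold_map n W \<theta> h ^^ t) x0) \<longlonglongrightarrow> all_one n}"

definition intervention_cost :: "nat \<Rightarrow> (nat \<Rightarrow> real \<Rightarrow> real) \<Rightarrow> (nat \<Rightarrow> real) \<Rightarrow> real" where
  "intervention_cost n C h = (\<Sum>i\<in>{1..n}. C i (h i))"

text \<open>
  The minimum over the (in general infinite) set of successful interventions is expressed with
  \<open>LEAST\<close>, which is only meaningful if this minimum is attained.
\<close>

definition least_activation_cost ::
  "nat \<Rightarrow> (nat \<Rightarrow> nat \<Rightarrow> real) \<Rightarrow> (nat \<Rightarrow> real) \<Rightarrow> (nat \<Rightarrow> real \<Rightarrow> real) \<Rightarrow> real" where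
  "least_activation_cost n W \<theta> C =
     (LEAST c. c \<in> intervention_cost n C ` successful_interventions n W \<theta>)"

text \<open>
  A permutation \<open>\<sigma>\<close> lists the nodes in the order \<open>\<sigma> 1, \<dots>, \<sigma> n\<close>; the position of node \<open>i\<close> in
  this list is \<open>inv \<sigma> i\<close>.
\<close>

definition preceding_weight :: "(nat \<Rightarrow> nat \<Rightarrow> real) \<Rightarrow> (nat \<Rightarrow> nat) \<Rightarrow> nat \<Rightarrow> real" where
  "preceding_weight W \<sigma> i = (\<Sum>s\<in>{1..<inv \<sigma> i}. W i (\<sigma> s))"

lemma preceding_weight_permutes:
  assumes "\<sigma> permutes {1..n}"
  shows "preceding_weight W \<sigma> (\<sigma> t) = (\<Sum>s\<in>{1..<t}. W (\<sigma> t) (\<sigma> s))"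
  by (simp add: preceding_weight_def permutes_inverses(2)[OF assms])

definition permutation_cost ::
  "nat \<Rightarrow> (nat \<Rightarrow> nat \<Rightarrow> real) \<Rightarrow> (nat \<Rightarrow> real) \<Rightarrow> (nat \<Rightarrow> real \<Rightarrow> real) \<Rightarrow> (nat \<Rightarrow> nat) \<Rightarrow> real" where
  "permutation_cost n W \<theta> C \<sigma> =
     (\<Sum>i\<in>{1..n}. C i (max 0 (\<theta> i * out_weight n W i - preceding_weight W \<sigma> i)))"

definition lower_semicontinuous_on :: "real set \<Rightarrow> (real \<Rightarrow> real) \<Rightarrow> bool" where
  "lower_semicontinuous_on S f \<longleftrightarrow>
     (\<forall>x\<in>S. \<forall>a<f x. \<forall>\<^sub>F y in at x within S. a < f y)"

end

theory Submission
  imports Defs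
begin

text \<open>
  Why the result holds: an intervention succeeds precisely when the nodes can be switched on one
  after another, in some order, each node needing only the weight it puts on the nodes before it
  in that order.

  Sufficiency (\<open>activation_order_imp_successful\<close>). Given such an order, whatever the initial
  state, the first \<open>t\<close> nodes of the order are active from time \<open>t\<close> on, because the weights are
  nonnegative and so the activity of later nodes can only help. Every orbit is thus constantly
  equal to the all-one state from time \<open>n\<close> on.

  Necessity (\<open>successful_imp_activation_order\<close>). If no node outside a proper subset \<open>A\<close> of the
  nodes can be activated by the weight it puts on \<open>A\<close>, then states supported in \<open>A\<close> are mapped to
  states supported in \<open>A\<close>, and the orbit of the zero state never becomes all-one. A successful
  intervention therefore allows every proper subset to be enlarged by an activatable node, and
  adding such nodes greedily from the empty set produces the order.

  For a fixed order \<open>\<sigma>\<close> the condition on the intervention is a separate lower bound on each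
  entry, so there is a least admissible intervention, with entries
  \<open>[\<theta>\<^sub>i w\<^sub>i - w\<^sub>i(\<sigma>)]\<^sup>+\<close>; its cost is that of \<open>\<sigma>\<close>. As the costs are monotone, it is the cheapest
  intervention admissible for \<open>\<sigma>\<close>, and minimising over interventions reduces to minimising over
  the finitely many orders. This also shows that the minimum is attained.
\<close>

section \<open>Activation orders suffice for success\<close>

definition activation_order ::
  "nat \<Rightarrow> (nat \<Rightarrow> nat \<Rightarrow> real) \<Rightarrow> (nat \<Rightarrow> real) \<Rightarrow> (nat \<Rightarrow> real) \<Rightarrow> (nat \<Rightarrow> nat) \<Rightarrow> bool" where
  "activation_order n W \<theta> h \<sigma> \<longleftrightarrow> \<sigma> permutes {1..n} \<and>
     (\<forall>i\<in>{1..n}. \<theta> i * out_weight n W i - h i \<le> preceding_weight W \<sigma> i)"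

lemma funpow_threshold_map_in_states:
  "x \<in> states n \<Longrightarrow> (threshold_map n W \<theta> h ^^ t) x \<in> states n"
  by (cases t) (simp_all add: threshold_map_in_states)

lemma states_values: "x \<in> states n \<Longrightarrow> i \<in> {1..n} \<Longrightarrow> x i = 0 \<or> x i = 1"
  unfolding states_def by fastforce

text \<open>
  Along an activation order the initial segment that is surely active grows by one node per time
  step. The statement speaks of all nodes up to position \<open>t\<close> at time \<open>t\<close>, so that a node, once active,
  stays active: its predecessors of the previous time step are still active.
\<close>

lemma activation_order_prefix_active:
  assumes nonneg: "\<And>i j. i \<in> {1..n} \<Longrightarrow> j \<in> {1..n} \<Longrightarrow> 0 \<le> W i j"
    and ord: "activation_order n W \<theta> h \<sigma>"
    and x0: "x0 \<in> states n"
    and s: "s \<in> {1..n}" "s \<le> t"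
  shows "(threshold_map n W \<theta> h ^^ t) x0 (\<sigma> s) = 1"
  using s
proof (induction t arbitrary: s)
  case 0
  then show ?case by simp
next
  case (Suc t)
  have perm: "\<sigma> permutes {1..n}"
    using ord by (simp add: activation_order_def)
  define x where "x = (threshold_map n W \<theta> h ^^ t) x0"
  have x: "x \<in> states n"
    unfolding x_def by (rule funpow_threshold_map_in_states[OF x0])
  have step: "(threshold_map n W \<theta> h ^^ Suc t) x0 = threshold_map n W \<theta> h x"
    by (simp add: x_def)
  have node: "\<sigma> s \<in> {1..n}"
    using permutes_in_image[OF perm] Suc.prems by simp
  have "\<theta> (\<sigma> s) * out_weight n W (\<sigma> s) - h (\<sigma> s) \<le> preceding_weight W \<sigma> (\<sigma> s)"
    using ord node by (simp add: activation_order_def)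
  also have "\<dots> = (\<Sum>r\<in>{1..<s}. W (\<sigma> s) (\<sigma> r))"
    by (rule preceding_weight_permutes[OF perm])
  also have "\<dots> = (\<Sum>r\<in>{1..<s}. W (\<sigma> s) (\<sigma> r) * x (\<sigma> r))"
    using Suc by (intro sum.cong) (auto simp: x_def)
  also have "\<dots> \<le> (\<Sum>r\<in>{1..n}. W (\<sigma> s) (\<sigma> r) * x (\<sigma> r))"
  proof (rule sum_mono2)
    fix r assume "r \<in> {1..n} - {1..<s}"
    then have "\<sigma> r \<in> {1..n}"
      using permutes_in_image[OF perm] by simp
    then show "0 \<le> W (\<sigma> s) (\<sigma> r) * x (\<sigma> r)"
      using nonneg[OF node] states_values[OF x, of "\<sigma> r"] by auto
  qed (use Suc.prems in auto)
  also have "\<dots> = (\<Sum>j\<in>{1..n}. W (\<sigma> s) j * x j)"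
    using sum.permute[OF perm, of "\<lambda>j. W (\<sigma> s) j * x j"] by (simp add: o_def)
  finally show ?case
    using node unfolding step by (simp add: threshold_map_def step_fun_def)
qed

lemma activation_order_imp_successful:
  assumes nonneg: "\<And>i j. i \<in> {1..n} \<Longrightarrow> j \<in> {1..n} \<Longrightarrow> 0 \<le> W i j"
    and h: "h \<in> {1..n} \<rightarrow>\<^sub>E {0..}"
    and ord: "activation_order n W \<theta> h \<sigma>"
  shows "h \<in> successful_interventions n W \<theta>"
  unfolding successful_interventions_def
proof (intro CollectI conjI ballI h)
  fix x0 assume x0: "x0 \<in> states n"
  have perm: "\<sigma> permutes {1..n}"
    using ord by (simp add: activation_order_def)
  have "(threshold_map n W \<theta> h ^^ t) x0 = all_one n" if t: "n \<le> t" for t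
  proof
    fix i
    show "(threshold_map n W \<theta> h ^^ t) x0 i = all_one n i"
    proof (cases "i \<in> {1..n}")
      case True
      then obtain s where "s \<in> {1..n}" "i = \<sigma> s"
        using permutes_image[OF perm] by blast
      with activation_order_prefix_active[OF nonneg ord x0] t True show ?thesis
        by (simp add: all_one_def)
    next
      case False
      with funpow_threshold_map_in_states[OF x0] show ?thesis
        by (metis PiE_arb all_one_def restrict_apply states_def)
    qed
  qed
  then show "(\<lambda>t. (threshold_map n W \<theta> h ^^ t) x0) \<longlonglongrightarrow> all_one n"
    by (intro tendsto_eventually eventually_sequentiallyI)
qed

section \<open>Successful interventions have activation orders\<close>

text \<open>
  A proper subset without this property would trap the orbit of the zero state: a node outside
  \<open>A\<close> receives at most the weight it puts on \<open>A\<close>, which is below the threshold lowered by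
  the intervention, and so stays at 0 forever, whereas convergence to the all-one state holds in every coordinate.
\<close>

lemma successful_imp_activatable_node:
  assumes nonneg: "\<And>i j. i \<in> {1..n} \<Longrightarrow> j \<in> {1..n} \<Longrightarrow> 0 \<le> W i j"
    and succ: "h \<in> successful_interventions n W \<theta>"
    and A: "A \<subset> {1..n}"
  shows "\<exists>i\<in>{1..n} - A. \<theta> i * out_weight n W i - h i \<le> (\<Sum>j\<in>A. W i j)"
proof (rule ccontr)
  assume "\<not> ?thesis"
  then have none: "\<forall>i\<in>{1..n} - A. \<not> \<theta> i * out_weight n W i - h i \<le> (\<Sum>j\<in>A. W i j)"
    by blast
  have below: "(\<Sum>j\<in>A. W i j) < \<theta> i * out_weight n W i - h i" if "i \<in> {1..n} - A" for i
    using none that by (simp only: not_le)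
  define x0 :: "nat \<Rightarrow> real" where "x0 = (\<lambda>i\<in>{1..n}. 0)"
  have x0: "x0 \<in> states n"
    by (auto simp: x0_def states_def)
  have trapped: "(threshold_map n W \<theta> h ^^ t) x0 i = 0" if "i \<in> {1..n} - A" for t i
    using that
  proof (induction t arbitrary: i)
    case 0
    then show ?case by (simp add: x0_def)
  next
    case (Suc t)
    define x where "x = (threshold_map n W \<theta> h ^^ t) x0"
    have x: "x \<in> states n"
      unfolding x_def by (rule funpow_threshold_map_in_states[OF x0])
    have step: "(threshold_map n W \<theta> h ^^ Suc t) x0 = threshold_map n W \<theta> h x"
      by (simp add: x_def)
    have "(\<Sum>j\<in>{1..n}. W i j * x j) = (\<Sum>j\<in>A. W i j * x j)"
      using A Suc.IH by (intro sum.mono_neutral_right) (auto simp: x_def)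
    also have "\<dots> \<le> (\<Sum>j\<in>A. W i j)"
    proof (rule sum_mono)
      fix j assume "j \<in> A"
      then have j: "j \<in> {1..n}"
        using A by blast
      show "W i j * x j \<le> W i j"
        using states_values[OF x j] nonneg[of i j] j Suc.prems by auto
    qed
    also have "\<dots> < \<theta> i * out_weight n W i - h i"
      by (rule below[OF Suc.prems])
    finally show ?case
      using Suc.prems unfolding step by (simp add: threshold_map_def step_fun_def)
  qed
  obtain i where i: "i \<in> {1..n} - A"
    using A by blast
  have "(\<lambda>t. (threshold_map n W \<theta> h ^^ t) x0) \<longlonglongrightarrow> all_one n"
    using succ x0 by (simp add: successful_interventions_def)
  from continuous_on_tendsto_compose[OF continuous_on_product_coordinates[of i] this]
  have "(\<lambda>t. (threshold_map n W \<theta> h ^^ t) x0 i) \<longlonglongrightarrow> all_one n i"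
    by simp
  with i have "(\<lambda>t::nat. 0::real) \<longlonglongrightarrow> 1"
    by (simp add: trapped all_one_def)
  then show False
    by (simp add: LIMSEQ_const_iff)
qed

text \<open>
  The order is built greedily: the first \<open>k\<close> positions are filled, by a map that is arbitrary at
  the other positions, and the set of nodes already placed is enlarged by an activatable node.
\<close>

lemma greedy_activation_prefix:
  fixes n k :: nat and a :: "nat \<Rightarrow> real" and W :: "nat \<Rightarrow> nat \<Rightarrow> real"
  assumes grow: "\<And>A. A \<subset> {1..n} \<Longrightarrow> \<exists>i\<in>{1..n} - A. a i \<le> (\<Sum>j\<in>A. W i j)"
    and "k \<le> n"
  shows "\<exists>\<sigma>. inj_on \<sigma> {1..k} \<and> \<sigma> ` {1..k} \<subseteq> {1..n} \<and>
           (\<forall>t\<in>{1..k}. a (\<sigma> t) \<le> (\<Sum>s\<in>{1..<t}. W (\<sigma> t) (\<sigma> s)))"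
  using \<open>k \<le> n\<close>
proof (induction k)
  case 0
  then show ?case by simp
next
  case (Suc k)
  then obtain \<sigma> where inj: "inj_on \<sigma> {1..k}" and sub: "\<sigma> ` {1..k} \<subseteq> {1..n}"
    and le: "\<And>t. t \<in> {1..k} \<Longrightarrow> a (\<sigma> t) \<le> (\<Sum>s\<in>{1..<t}. W (\<sigma> t) (\<sigma> s))"
    by auto
  have "card (\<sigma> ` {1..k}) = k"
    using card_image[OF inj] by simp
  with Suc.prems sub have proper: "\<sigma> ` {1..k} \<subset> {1..n}"
    by auto
  obtain i where i: "i \<in> {1..n} - \<sigma> ` {1..k}" and ai: "a i \<le> (\<Sum>j\<in>\<sigma> ` {1..k}. W i j)"
    using grow[OF proper] by (elim bexE)
  define \<tau> where "\<tau> = \<sigma>(Suc k := i)"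
  have insert_k: "{1..Suc k} = insert (Suc k) {1..k}"
    by auto
  have image: "\<tau> ` {1..k} = \<sigma> ` {1..k}"
    by (rule image_cong) (simp_all add: \<tau>_def)
  have "inj_on \<tau> {1..k}"
    using inj by (subst inj_on_cong[of "{1..k}" \<tau> \<sigma>]) (simp_all add: \<tau>_def)
  moreover have "\<tau> (Suc k) \<notin> \<tau> ` {1..k}"
    unfolding image using i by (simp add: \<tau>_def)
  ultimately have "inj_on \<tau> {1..Suc k}"
    unfolding insert_k by simp
  moreover have "\<tau> ` {1..Suc k} \<subseteq> {1..n}"
    unfolding insert_k image_insert image using sub i by (simp add: \<tau>_def)
  moreover have "a (\<tau> t) \<le> (\<Sum>s\<in>{1..<t}. W (\<tau> t) (\<tau> s))" if t: "t \<in> {1..Suc k}" for t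
  proof -
    have same: "(\<Sum>s\<in>{1..<t}. W (\<tau> t) (\<tau> s)) = (\<Sum>s\<in>{1..<t}. W (\<tau> t) (\<sigma> s))"
      using t by (intro sum.cong) (auto simp: \<tau>_def)
    show ?thesis
    proof (cases "t = Suc k")
      case True
      have "(\<Sum>j\<in>\<sigma> ` {1..k}. W i j) = (\<Sum>s\<in>{1..<Suc k}. W i (\<sigma> s))"
        unfolding sum.reindex[OF inj] atLeastLessThanSuc_atLeastAtMost by simp
      with ai same True show ?thesis
        by (simp add: \<tau>_def)
    next
      case False
      with le[of t] same t show ?thesis
        by (simp add: \<tau>_def)
    qed
  qed
  ultimately show ?case
    by blast
qed

lemma successful_imp_activation_order:
  assumes nonneg: "\<And>i j. i \<in> {1..n} \<Longrightarrow> j \<in> {1..n} \<Longrightarrow> 0 \<le> W i j"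
    and succ: "h \<in> successful_interventions n W \<theta>"
  shows "\<exists>\<sigma>. activation_order n W \<theta> h \<sigma>"
proof -
  define a where "a i = \<theta> i * out_weight n W i - h i" for i
  obtain \<sigma> where inj: "inj_on \<sigma> {1..n}" and sub: "\<sigma> ` {1..n} \<subseteq> {1..n}"
    and le: "\<And>t. t \<in> {1..n} \<Longrightarrow> a (\<sigma> t) \<le> (\<Sum>s\<in>{1..<t}. W (\<sigma> t) (\<sigma> s))"
    using greedy_activation_prefix[of n a W n] successful_imp_activatable_node[OF nonneg succ]
    unfolding a_def by blast
  define \<tau> where "\<tau> t = (if t \<in> {1..n} then \<sigma> t else t)" for t
  have "bij_betw \<sigma> {1..n} {1..n}"
    using inj endo_inj_surj[OF _ sub inj] by (simp add: bij_betw_def)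
  then have "bij_betw \<tau> {1..n} {1..n}"
    using bij_betw_cong[of "{1..n}" \<tau> \<sigma>] by (simp add: \<tau>_def)
  then have perm: "\<tau> permutes {1..n}"
    by (rule bij_imp_permutes) (auto simp: \<tau>_def)
  have "a i \<le> preceding_weight W \<tau> i" if i: "i \<in> {1..n}" for i
  proof -
    obtain t where t: "t \<in> {1..n}" "i = \<tau> t"
      using i permutes_image[OF perm] by blast
    have eq: "\<tau> s = \<sigma> s" if "s \<in> {1..t}" for s
      using that t(1) by (simp add: \<tau>_def)
    have "a (\<tau> t) = a (\<sigma> t)"
      using eq t(1) by simp
    also have "\<dots> \<le> (\<Sum>s\<in>{1..<t}. W (\<sigma> t) (\<sigma> s))"
      by (rule le[OF t(1)])
    also have "\<dots> = (\<Sum>s\<in>{1..<t}. W (\<tau> t) (\<tau> s))"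
      using t(1) by (intro sum.cong) (simp_all add: eq)
    also have "\<dots> = preceding_weight W \<tau> (\<tau> t)"
      by (rule preceding_weight_permutes[OF perm, symmetric])
    finally show ?thesis
      by (simp only: t(2))
  qed
  with perm show ?thesis
    by (auto simp: activation_order_def a_def)
qed

section \<open>Costs of orders and of interventions\<close>

text \<open>
  The witness is the least intervention for which \<open>\<sigma>\<close> is an activation order.
\<close>

lemma permutation_cost_attained:
  assumes nonneg: "\<And>i j. i \<in> {1..n} \<Longrightarrow> j \<in> {1..n} \<Longrightarrow> 0 \<le> W i j"
    and perm: "\<sigma> permutes {1..n}"
  shows "\<exists>h\<in>successful_interventions n W \<theta>.
           intervention_cost n C h = permutation_cost n W \<theta> C \<sigma>"
proof
  let ?h = "\<lambda>i\<in>{1..n}. max 0 (\<theta> i * out_weight n W i - preceding_weight W \<sigma> i)"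
  show "?h \<in> successful_interventions n W \<theta>"
    using nonneg perm
    by (intro activation_order_imp_successful) (auto simp: activation_order_def)
  show "intervention_cost n C ?h = permutation_cost n W \<theta> C \<sigma>"
    by (simp add: intervention_cost_def permutation_cost_def)
qed

lemma permutation_cost_le_intervention_cost:
  assumes mono: "\<And>i. i \<in> {1..n} \<Longrightarrow> mono_on {0..} (C i)"
    and h: "h \<in> {1..n} \<rightarrow> {0..}"
    and ord: "activation_order n W \<theta> h \<sigma>"
  shows "permutation_cost n W \<theta> C \<sigma> \<le> intervention_cost n C h"
  unfolding permutation_cost_def intervention_cost_def
proof (rule sum_mono)
  fix i assume i: "i \<in> {1..n}"
  have "0 \<le> h i"
    using h i by auto
  moreover have "\<theta> i * out_weight n W i - preceding_weight W \<sigma> i \<le> h i"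
    using ord i by (auto simp: activation_order_def algebra_simps)
  ultimately show "C i (max 0 (\<theta> i * out_weight n W i - preceding_weight W \<sigma> i)) \<le> C i (h i)"
    by (intro mono_onD[OF mono[OF i]]) auto
qed

theorem proposition3p1:
  fixes n :: nat
    and E :: "(nat \<times> nat) set"
    and W :: "nat \<Rightarrow> nat \<Rightarrow> real"
    and \<theta> :: "nat \<Rightarrow> real"
    and C :: "nat \<Rightarrow> real \<Rightarrow> real"
  assumes "weighted_digraph n E W"
    and "\<forall>i\<in>{1..n}. \<theta> i \<in> {0..1}"
    and "\<forall>i\<in>{1..n}. C i \<in> {0..} \<rightarrow> {0..}"
    and "\<forall>i\<in>{1..n}. mono_on {0..} (C i)"
    and "\<forall>i\<in>{1..n}. lower_semicontinuous_on {0..} (C i)"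
  shows "(\<exists>h\<in>successful_interventions n W \<theta>.
            intervention_cost n C h = least_activation_cost n W \<theta> C) \<and>
         (\<forall>h\<in>successful_interventions n W \<theta>.
            least_activation_cost n W \<theta> C \<le> intervention_cost n C h) \<and>
         least_activation_cost n W \<theta> C =
           Min (permutation_cost n W \<theta> C ` {\<sigma>. \<sigma> permutes {1..n}})"
proof -
  have nonneg: "0 \<le> W i j" if "i \<in> {1..n}" "j \<in> {1..n}" for i j
    using assms(1) that by (auto simp: weighted_digraph_def)
  let ?P = "{\<sigma>. \<sigma> permutes {1..n}}"
  let ?m = "Min (permutation_cost n W \<theta> C ` ?P)"
  have fin: "finite (permutation_cost n W \<theta> C ` ?P)"
    by (intro finite_imageI finite_permutations) simp
  moreover have "id \<in> ?P"
    by (simp add: permutes_id)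
  ultimately have "?m \<in> permutation_cost n W \<theta> C ` ?P"
    by (intro Min_in) blast+
  then obtain h where h: "h \<in> successful_interventions n W \<theta>" "intervention_cost n C h = ?m"
    using permutation_cost_attained[where C = C and \<theta> = \<theta>, OF nonneg] by force
  have lower: "?m \<le> intervention_cost n C g" if g: "g \<in> successful_interventions n W \<theta>" for g
  proof -
    obtain \<sigma> where ord: "activation_order n W \<theta> g \<sigma>"
      using successful_imp_activation_order[OF nonneg g] by blast
    then have "?m \<le> permutation_cost n W \<theta> C \<sigma>"
      using fin by (intro Min_le) (auto simp: activation_order_def)
    also have "\<dots> \<le> intervention_cost n C g"
      using assms(4) g ord
      by (intro permutation_cost_le_intervention_cost) (auto simp: successful_interventions_def)
    finally show ?thesis .
  qed
  have "least_activation_cost n W \<theta> C = ?m"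
    unfolding least_activation_cost_def
  proof (rule Least_equality)
    show "?m \<in> intervention_cost n C ` successful_interventions n W \<theta>"
      using h by force
  qed (use lower in blast)
  with h lower show ?thesis
    by auto
qed

end
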